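(* Fix $k \in \mathbb{Z}_{\ge 0}$, $b \in \{0,1,2\}$, and an integer $m > 24k + 12 - 8b$ with $m \equiv b \pmod 3$. Then for every integer $n \ge m$ with $n \equiv b \pmod 3$, $$h_{n, d_n - k} = \sum_{l=0}^{k} h_{m, d_m - l} \binom{d_n - d_m}{k-l}.$$
   Context: A numerical semigroup is a subset of $\mathbb{Z}_{\ge 0}$ containing $0$ and closed under addition; $\langle A\rangle$ denotes the numerical semigroup generated by $A \subset \mathbb{Z}_{\ge 1}$ (all finite non-negative integer combinations of elements of $A$). A set $A$ minimally generates $\langle A \rangle$ if $\langle A \setminus\{x\}\rangle \ne \langle A \rangle$ for every $x \in A$. For $n \in \mathbb{Z}_{\ge 1}$ and $i \in \mathbb{Z}_{\ge 0}$, $h_{n,i}$ is the number of sets $A \subset [1, n/2) \cap \mathbb{Z}$ with $|A| = i$ that minimally generate a numerical semigroup with $n \notin \langle A \rangle$. For $n \in \mathbb{Z}_{\ge 1}$, $d_n = |(n/3, n/2) \cap \mathbb{Z}| = \lfloor (n-1)/2 \rfloor - \lfloor n/3 \rfloor$ (number of integers strictly between $n/3$ and $n/2$). Binomial coefficients $\binom{a}{j}$ with $j > a \ge 0$ are $0$. *)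

theory Defs
  imports Complex_Main
begin

text \<open>As in the source, a numerical semigroup need not have finite complement.\<close>

definition numerical_semigroup :: "nat set \<Rightarrow> bool" where
  "numerical_semigroup S \<longleftrightarrow> 0 \<in> S \<and> (\<forall>x\<in>S. \<forall>y\<in>S. x + y \<in> S)"

definition generated :: "nat set \<Rightarrow> nat set" where
  "generated A = {\<Sum>a\<in>F. c a * a | F c. finite F \<and> F \<subseteq> A}"

lemma generated_eq_hull: "generated A = numerical_semigroup hull A"
proof (rule hull_unique[symmetric])
  show "A \<subseteq> generated A"
  proof
    fix a assume "a \<in> A"
    then have "a = (\<Sum>x\<in>{a}. 1 * x) \<and> finite {a} \<and> {a} \<subseteq> A" by simp
    then show "a \<in> generated A"
      unfolding generated_def by (intro CollectI exI[of _ "{a}"] exI[of _ "\<lambda>_. 1"])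
  qed
  show "numerical_semigroup (generated A)"
    unfolding numerical_semigroup_def
  proof (intro conjI ballI)
    show "0 \<in> generated A"
      unfolding generated_def by (intro CollectI exI[of _ "{}"]) simp
    fix x y assume "x \<in> generated A" "y \<in> generated A"
    then obtain F c G e where
      F: "finite F" "F \<subseteq> A" "x = (\<Sum>a\<in>F. c a * a)" and
      G: "finite G" "G \<subseteq> A" "y = (\<Sum>a\<in>G. e a * a)"
      unfolding generated_def by blast
    have x: "x = (\<Sum>a\<in>F \<union> G. (if a \<in> F then c a else 0) * a)"
      unfolding F(3) using F(1) G(1) by (intro sum.mono_neutral_cong_left) auto
    have y: "y = (\<Sum>a\<in>F \<union> G. (if a \<in> G then e a else 0) * a)"
      unfolding G(3) using F(1) G(1) by (intro sum.mono_neutral_cong_left) auto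
    have "x + y = (\<Sum>a\<in>F \<union> G. ((if a \<in> F then c a else 0) + (if a \<in> G then e a else 0)) * a)"
      unfolding x y sum.distrib[symmetric] distrib_right ..
    moreover have "finite (F \<union> G)" "F \<union> G \<subseteq> A" using F G by auto
    ultimately show "x + y \<in> generated A"
      unfolding generated_def
      by (intro CollectI exI[of _ "F \<union> G"]
            exI[of _ "\<lambda>a. (if a \<in> F then c a else 0) + (if a \<in> G then e a else 0)"]) simp
  qed
  fix S assume S: "A \<subseteq> S" "numerical_semigroup S"
  then have zero: "0 \<in> S" and add: "\<And>x y. x \<in> S \<Longrightarrow> y \<in> S \<Longrightarrow> x + y \<in> S"
    unfolding numerical_semigroup_def by auto
  have mult: "k * a \<in> S" if "a \<in> A" for k a
    using that S(1) zero add by (induction k) auto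
  have "(\<Sum>a\<in>F. c a * a) \<in> S" if "finite F" "F \<subseteq> A" for F and c :: "nat \<Rightarrow> nat"
    using that zero by (induction F rule: finite_induct) (auto intro: add mult)
  then show "generated A \<subseteq> S" unfolding generated_def by auto
qed

definition minimally_generating :: "nat set \<Rightarrow> bool" where
  "minimally_generating A \<longleftrightarrow> (\<forall>x\<in>A. generated (A - {x}) \<noteq> generated A)"

definition h :: "nat \<Rightarrow> nat \<Rightarrow> nat" where
  "h n i = card {A :: nat set. A \<subseteq> {a. 1 \<le> a \<and> real a < real n / 2} \<and> card A = i
      \<and> minimally_generating A \<and> n \<notin> generated A}"

definition d :: "nat \<Rightarrow> nat" where
  "d n = card {x :: nat. real n / 3 < real x \<and> real x < real n / 2}"

lemma d_eq: "d n = (n - 1) div 2 - n div 3"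
proof -
  have "{x :: nat. real n / 3 < real x \<and> real x < real n / 2} = {n div 3<..(n - 1) div 2}"
    by auto
  then show ?thesis unfolding d_def by simp
qed

text \<open>The truncated subtractions of the form \<open>d n - k\<close>, \<open>d m - l\<close> and \<open>d n - d m\<close> agree
  with integer subtraction in the range considered:\<close>

lemma d_ge:
  assumes "b \<in> {0, 1, 2}" and "int m > 24 * int k + 12 - 8 * int b"
  shows "k \<le> d m"
proof (cases "k = 0")
  case False
  define p q where "p = (m - 1) div 2" and "q = m div 3"
  have "m + 4 > 24 * k" using assms by auto
  moreover have "m \<le> 2 * p + 2" "3 * q \<le> m" unfolding p_def q_def by auto
  ultimately have "k + q \<le> p" using False by linarith
  then show ?thesis unfolding d_eq p_def[symmetric] q_def[symmetric] by linarith
qed simp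

lemma d_mono_mod_3:
  assumes "m \<le> n" and "m mod 3 = n mod 3"
  shows "d m \<le> d n"
proof -
  have "3 dvd n - m" using assms mod_eq_dvd_iff_nat by metis
  then obtain j where j: "n = m + 3 * j" using assms(1) by (metis dvdE le_add_diff_inverse)
  have "n div 3 = m div 3 + j" unfolding j by simp
  moreover have "(m - 1) div 2 + j \<le> (n - 1) div 2"
  proof -
    have "(m - 1) div 2 + j = (m - 1 + 2 * j) div 2" by simp
    also have "\<dots> \<le> (n - 1) div 2" unfolding j by (intro div_le_mono) (cases j, auto)
    finally show ?thesis .
  qed
  ultimately show ?thesis unfolding d_eq by linarith
qed

end

theory Submission
  imports Defs
begin

text \<open>
  Write \<open>n = 3 q + b\<close>.  If \<open>x \<in> A\<close>, minimality makes the elements of \<open>A\<close> distinct modulo \<open>x\<close>, and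
  \<open>n \<notin> \<langle>A\<rangle>\<close> forbids \<open>a + a' \<equiv> n\<close> modulo \<open>x\<close> because \<open>a + a' < n\<close>.  So the residues of \<open>A\<close>
  and of \<open>n - A\<close> are disjoint and \<open>2 |A| \<le> x\<close>, with strict inequality for even \<open>n\<close> since the residue
  of \<open>n / 2\<close> is missed.  For \<open>|A| \<ge> d\<^sub>n - k\<close> this gives \<open>x \<ge> q - K\<close> with \<open>K = 2 k + 1 - b\<close>.  Once all
  elements are this large, only sums of exactly three elements can equal \<open>n\<close>, and minimality is
  automatic.  After translation by \<open>q\<close> the condition reads \<open>s + t + u \<noteq> b\<close> on subsets of
  \<open>{-K..d\<^sub>n}\<close>.  It does not depend on \<open>q\<close>, and the elements above \<open>b + 2 K \<le> d\<^sub>m\<close> are unconstrained;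
  choosing those in \<open>{d\<^sub>m<..d\<^sub>n}\<close> freely produces the binomial coefficients.
\<close>

section \<open>Semigroup hulls and minimal generation\<close>

lemma mod_add_right_cancel_nat:
  fixes a c e x :: nat
  shows "(a + e) mod x = (c + e) mod x \<longleftrightarrow> a mod x = c mod x"
  unfolding nat_mod_eq_iff by (simp add: ac_simps)

lemma subset_generated: "A \<subseteq> generated A"
  unfolding generated_eq_hull by (rule hull_subset)

lemma generated_mono: "A \<subseteq> B \<Longrightarrow> generated A \<subseteq> generated B"
  unfolding generated_eq_hull by (rule hull_mono)

lemma generated_minimal: "A \<subseteq> S \<Longrightarrow> numerical_semigroup S \<Longrightarrow> generated A \<subseteq> S"
  unfolding generated_eq_hull by (rule hull_minimal)

lemma numerical_semigroup_generated: "numerical_semigroup (generated A)"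
  unfolding generated_eq_hull
  by (rule hull_in) (auto simp: numerical_semigroup_def)

lemma generated_zero: "0 \<in> generated A"
  and generated_add: "x \<in> generated A \<Longrightarrow> y \<in> generated A \<Longrightarrow> x + y \<in> generated A"
  using numerical_semigroup_generated[of A] by (auto simp: numerical_semigroup_def)

lemma generated_mult: "x \<in> generated A \<Longrightarrow> j * x \<in> generated A"
  by (induction j) (auto intro: generated_zero generated_add)

lemma minimally_generating_iff:
  "minimally_generating A \<longleftrightarrow> (\<forall>x\<in>A. x \<notin> generated (A - {x}))"
proof -
  have "generated (A - {x}) = generated A \<longleftrightarrow> x \<in> generated (A - {x})" if "x \<in> A" for x
  proof
    assume "x \<in> generated (A - {x})"
    then have "A \<subseteq> generated (A - {x})"
      using subset_generated[of "A - {x}"] by blast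
    then show "generated (A - {x}) = generated A"
      using generated_mono[of "A - {x}" A]
        generated_minimal[OF _ numerical_semigroup_generated] by blast
  qed (use that subset_generated in blast)
  then show ?thesis unfolding minimally_generating_def by blast
qed

section \<open>Residues modulo an element, and the size bounds they give\<close>

definition admissible :: "nat \<Rightarrow> nat set \<Rightarrow> bool" where
  "admissible n A \<longleftrightarrow> A \<subseteq> {a. 1 \<le> a \<and> 2 * a < n} \<and> minimally_generating A \<and> n \<notin> generated A"

lemma h_eq: "h n i = card {A. admissible n A \<and> card A = i}"
proof -
  have "real a < real n / 2 \<longleftrightarrow> 2 * a < n" for a by linarith
  then show ?thesis
    unfolding h_def admissible_def by (intro arg_cong[of _ _ card]) auto
qed

lemma admissible_finite: "admissible n A \<Longrightarrow> finite A"
  by (rule finite_subset[of _ "{..n}"]) (auto simp: admissible_def)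

text \<open>Of two congruent elements, the larger is the smaller plus a multiple of
  \<open>x\<close>, so it would be a redundant generator.\<close>

lemma admissible_inj_on_mod:
  assumes "admissible n A" "x \<in> A"
  shows "inj_on (\<lambda>a. a mod x) A"
proof (rule linorder_inj_onI)
  fix a c assume ac: "a < c" "a \<in> A" "c \<in> A"
  show "a mod x \<noteq> c mod x"
  proof
    assume eq: "a mod x = c mod x"
    then obtain j where j: "c = a + x * j"
      using ac(1) by (metis mod_eq_dvd_iff_nat dvdE le_add_diff_inverse less_imp_le)
    have "1 \<le> a" using assms(1) ac(2) by (auto simp: admissible_def)
    \<comment> \<open>If \<open>x = c\<close>, then \<open>a mod x = 0\<close> although
      \<open>0 < a < x\<close>. Hence removing \<open>c\<close> keeps both \<open>a\<close> and
      \<open>x\<close> available.\<close>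
    then have "x \<noteq> c" using eq ac(1) by auto
    then have "a \<in> generated (A - {c})" "x \<in> generated (A - {c})"
      using subset_generated[of "A - {c}"] ac assms(2) by auto
    then have "c \<in> generated (A - {c})"
      unfolding j by (metis generated_add generated_mult mult.commute)
    then show False
      using assms(1) ac(3) by (auto simp: admissible_def minimally_generating_iff)
  qed
qed auto

lemma admissible_sum_mod:
  assumes "admissible n A" "x \<in> A" "a \<in> A" "c \<in> A"
  shows "(a + c) mod x \<noteq> n mod x"
proof
  assume eq: "(a + c) mod x = n mod x"
  have "2 * a < n" "2 * c < n" using assms by (auto simp: admissible_def)
  then have "a + c \<le> n" by linarith
  then obtain j where j: "n = a + c + x * j"
    using eq by (metis mod_eq_dvd_iff_nat dvdE le_add_diff_inverse)
  have "n \<in> generated A"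
    unfolding j using assms subset_generated
    by (metis generated_add generated_mult mult.commute subsetD)
  then show False using assms(1) by (auto simp: admissible_def)
qed

text \<open>The residues of \<open>A\<close>, of its reflection \<open>n - A\<close> and, for even
  \<open>n\<close>, of \<open>n div 2\<close> are pairwise disjoint subsets of
  \<open>{..<x}\<close>; counting them gives the bound.\<close>

lemma admissible_card_le:
  assumes adm: "admissible n A" and x: "x \<in> A"
  shows "2 * card A + (if even n then 1 else 0) \<le> x"
proof -
  have lt: "1 \<le> a \<and> 2 * a < n" if "a \<in> A" for a
    using adm that by (auto simp: admissible_def)
  have xpos: "x > 0" using lt[OF x] by simp
  let ?R = "(\<lambda>a. a mod x) ` A" and ?R' = "(\<lambda>a. (n - a) mod x) ` A"
  let ?H = "if even n then {(n div 2) mod x} else {}"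
  have reflect: "(a + c) mod x = n mod x" if "a \<in> A" "c mod x = (n - a) mod x" for a c
  proof -
    have "(a + c) mod x = (a + (n - a)) mod x"
      using that(2) by (metis mod_add_right_eq)
    then show ?thesis using lt[OF that(1)] by simp
  qed
  have inj: "inj_on (\<lambda>a. (n - a) mod x) A"
  proof (rule inj_onI)
    fix a c assume ac: "a \<in> A" "c \<in> A" "(n - a) mod x = (n - c) mod x"
    have "(a + (n - c)) mod x = (c + (n - c)) mod x"
      using reflect[of a "n - c"] ac lt[OF ac(2)] by simp
    then have "a mod x = c mod x" by (simp add: mod_add_right_cancel_nat)
    then show "a = c" using admissible_inj_on_mod[OF adm x] ac by (auto dest: inj_onD)
  qed
  have disj: "?R \<inter> ?R' = {}"
    using reflect admissible_sum_mod[OF adm x] by fastforce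
  have half: "(?R \<union> ?R') \<inter> ?H = {}"
  proof -
    have H1: "a mod x \<noteq> (n div 2) mod x" if "even n" "a \<in> A" for a
    proof
      assume "a mod x = (n div 2) mod x"
      then have "(a + a) mod x = (n div 2 + n div 2) mod x"
        by (metis mod_add_eq)
      also have "n div 2 + n div 2 = n" using that(1) by auto
      finally show False using admissible_sum_mod[OF adm x that(2) that(2)] by simp
    qed
    \<comment> \<open>The residue of \<open>n div 2\<close> is fixed by the reflection, so this case
      falls back on \<open>H1\<close>.\<close>
    have H2: "(n - a) mod x \<noteq> (n div 2) mod x" if "even n" "a \<in> A" for a
    proof
      assume "(n - a) mod x = (n div 2) mod x"
      then have "(a + n div 2) mod x = (n div 2 + n div 2) mod x"
        using reflect[OF that(2), of "n div 2"] that(1) by (metis dvd_mult_div_cancel mult_2)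
      then have "a mod x = (n div 2) mod x" by (simp add: mod_add_right_cancel_nat)
      then show False using H1[OF that] by simp
    qed
    show ?thesis using H1 H2 by (auto split: if_splits dest: sym)
  qed
  have fin: "finite A" using admissible_finite[OF adm] .
  have "2 * card A + (if even n then 1 else 0) = card (?R \<union> ?R' \<union> ?H)"
    using fin disj half inj admissible_inj_on_mod[OF adm x]
    by (subst card_Un_disjoint; simp add: card_Un_disjoint card_image)
  also have "\<dots> \<le> card {..<x}"
    using xpos by (intro card_mono) auto
  finally show ?thesis by simp
qed

text \<open>For \<open>n > 0\<close>, \<open>n div 3 + n mod 3\<close> equals
  \<open>2 * d n + 1\<close>, plus 1 if \<open>n\<close> is even. The parity term is the one in
  \<open>admissible_card_le\<close>, so it cancels and leaves a bound uniform in the parity.\<close>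

lemma admissible_ge:
  assumes "admissible n A" "x \<in> A"
  shows "n div 3 + n mod 3 + 2 * card A \<le> x + 2 * d n + 1"
proof -
  define q r where "q = n div 3" and "r = n mod 3"
  have n: "n = 3 * q + r" unfolding q_def r_def by simp
  have "q + r \<le> 2 * ((n - 1) div 2 - q) + 1 + (if even n then 1 else 0)"
  proof (cases "even n")
    case True
    then obtain e where "n = 2 * e" by (elim evenE)
    moreover from this have "(n - 1) div 2 = e - 1" by auto
    ultimately show ?thesis using n True by auto
  next
    case False
    then obtain e where "n = 2 * e + 1" by (elim oddE)
    moreover from this have "(n - 1) div 2 = e" by auto
    ultimately show ?thesis using n False by auto
  qed
  then have "n div 3 + n mod 3 \<le> 2 * d n + 1 + (if even n then 1 else 0)"
    unfolding d_eq q_def r_def .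
  then show ?thesis
    using admissible_card_le[OF assms] by linarith
qed

text \<open>With more than \<open>d n\<close> elements, \<open>admissible_ge\<close> pushes all of
  \<open>A\<close> above \<open>n / 3\<close>, into an interval that holds only \<open>d n\<close>
  integers.\<close>

lemma admissible_card_le_d:
  assumes "admissible n A"
  shows "card A \<le> d n"
proof (rule ccontr)
  assume "\<not> card A \<le> d n"
  then have "A \<subseteq> {n div 3<..(n - 1) div 2}"
    using admissible_ge[OF assms] assms by (fastforce simp: admissible_def)
  then have "card A \<le> d n"
    unfolding d_eq using card_mono[of "{n div 3<..(n - 1) div 2}"] by simp
  then show False using \<open>\<not> card A \<le> d n\<close> by simp
qed

section \<open>Large generators: only triple sums matter\<close>

text \<open>Splits by the number of summands, counted with multiplicity; representing sums by lists
  makes that number a length.\<close>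

lemma generated_cases:
  assumes "y \<in> generated A" and L: "\<And>a. a \<in> A \<Longrightarrow> L \<le> a"
  obtains "y = 0" | "y \<in> A" | a c where "a \<in> A" "c \<in> A" "y = a + c"
    | a c e where "a \<in> A" "c \<in> A" "e \<in> A" "y = a + c + e" | "y \<ge> 4 * L"
proof -
  define S where "S j = {y. \<exists>xs. set xs \<subseteq> A \<and> length xs = j \<and> y = sum_list xs}" for j
  have "generated A \<subseteq> (\<Union>j. S j)"
  proof (rule generated_minimal)
    have "a \<in> S 1" if "a \<in> A" for a
      unfolding S_def using that by (auto intro!: exI[of _ "[a]"])
    then show "A \<subseteq> (\<Union>j. S j)" by blast
    have "0 \<in> S 0" unfolding S_def by auto
    moreover have "y + z \<in> S (i + j)" if "y \<in> S i" "z \<in> S j" for y z i j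
    proof -
      from that obtain xs ys where "set (xs @ ys) \<subseteq> A" "length (xs @ ys) = i + j"
        "y + z = sum_list (xs @ ys)"
        unfolding S_def by auto
      then show ?thesis unfolding S_def by blast
    qed
    ultimately show "numerical_semigroup (\<Union>j. S j)"
      unfolding numerical_semigroup_def by blast
  qed
  then obtain xs where xs: "set xs \<subseteq> A" "y = sum_list xs"
    using assms(1) unfolding S_def by auto
  have len: "length xs * L \<le> sum_list xs"
    using xs(1) L by (induction xs) (auto intro: add_mono)
  show ?thesis
  proof (cases "length xs \<ge> 4")
    case True
    then have "4 * L \<le> y" using len xs(2) by (metis mult_le_mono1 le_trans)
    then show ?thesis using that by blast
  next
    case False
    then consider "length xs = 0" | "length xs = 1" | "length xs = 2" | "length xs = 3" by linarith
    then show ?thesis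
      by cases (use xs that in \<open>auto simp: length_Suc_conv numeral_eq_Suc add.assoc\<close>)
  qed
qed

text \<open>Elements lie in \<open>[L, n/2)\<close> with \<open>4 * L > n\<close>: at most two
  summands stay below \<open>n\<close>, four or more exceed it. Minimality is automatic, since
  already two summands reach \<open>2 * L > n/2\<close>.\<close>

lemma admissible_iff_sum_free:
  assumes A: "A \<subseteq> {a. L \<le> a \<and> 2 * a < n}" and L: "n < 4 * L" and n: "0 < n"
  shows "admissible n A \<longleftrightarrow> (\<forall>a\<in>A. \<forall>c\<in>A. \<forall>e\<in>A. a + c + e \<noteq> n)"
proof
  assume "admissible n A"
  moreover have "a + c + e \<in> generated A" if "a \<in> A" "c \<in> A" "e \<in> A" for a c e
    using that subset_generated by (meson generated_add subsetD)
  ultimately show "\<forall>a\<in>A. \<forall>c\<in>A. \<forall>e\<in>A. a + c + e \<noteq> n"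
    unfolding admissible_def by blast
next
  assume sum_free: "\<forall>a\<in>A. \<forall>c\<in>A. \<forall>e\<in>A. a + c + e \<noteq> n"
  have bd: "L \<le> a \<and> 2 * a < n \<and> 0 < a" if "a \<in> A" for a
    using A L that by fastforce
  have "x \<notin> generated (A - {x})" if x: "x \<in> A" for x
  proof
    assume "x \<in> generated (A - {x})"
    then show False
    proof (rule generated_cases[where L = L])
      fix a c assume "a \<in> A - {x}" "c \<in> A - {x}" "x = a + c"
      then show False using bd[of a] bd[of c] bd[OF x] L by auto
    next
      fix a c e assume "a \<in> A - {x}" "c \<in> A - {x}" "x = a + c + e"
      then show False using bd[of a] bd[of c] bd[OF x] L by auto
    qed (use bd bd[OF x] L in auto)
  qed
  moreover have "n \<notin> generated A"
  proof
    assume "n \<in> generated A"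
    then show False
    proof (rule generated_cases[where L = L])
      fix a c assume "a \<in> A" "c \<in> A" "n = a + c"
      then show False using bd[of a] bd[of c] by auto
    next
      assume "n \<in> A"
      then show False using bd by fastforce
    qed (use bd L n sum_free in auto)
  qed
  ultimately show "admissible n A"
    unfolding admissible_def minimally_generating_iff using bd by fastforce
qed

section \<open>Translation to integer sets near zero\<close>

definition sum_free_sets :: "int \<Rightarrow> int \<Rightarrow> int \<Rightarrow> nat \<Rightarrow> int set set" where
  "sum_free_sets b K D i =
    {T. T \<subseteq> {-K..D} \<and> card T = i \<and> (\<forall>s\<in>T. \<forall>t\<in>T. \<forall>u\<in>T. s + t + u \<noteq> b)}"

text \<open>The bijection is translation by \<open>q = n div 3\<close>. For
  \<open>d n \<le> i + k\<close>, \<open>admissible_ge\<close> gives \<open>x \<ge> q - K\<close>,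
  which dictates \<open>K\<close>; the hypothesis \<open>4 * K + b < q\<close> says exactly that
  \<open>n < 4 * (q - K)\<close>.\<close>

lemma h_eq_card_sum_free_sets:
  fixes k n :: nat
  defines "b \<equiv> int (n mod 3)"
  defines "K \<equiv> 2 * int k + 1 - b"
  assumes n: "4 * K + b < int (n div 3)" and i: "d n \<le> i + k"
  shows "h n i = card (sum_free_sets b K (d n) i)"
proof -
  define q where "q = int (n div 3)"
  let ?f = "\<lambda>a. int a - q" and ?g = "\<lambda>t. nat (t + q)"
  have nq: "int n = 3 * q + b" unfolding q_def b_def by presburger
  have b: "0 \<le> b" "b \<le> 2" unfolding b_def by auto
  have Kq: "4 * K + b < q" "-1 \<le> K" using n b unfolding q_def K_def by auto
  have npos: "0 < n"
  proof (rule ccontr)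
    assume "\<not> 0 < n"
    then have "q = 0" "b = 0" unfolding q_def b_def by auto
    then show False using Kq unfolding K_def by simp
  qed
  define L where "L = nat (q - K)"
  have L: "int L = q - K" unfolding L_def using Kq b by (simp add: q_def)
  have L4: "n < 4 * L" using nq Kq L by linarith
  have d: "2 * a < n \<longleftrightarrow> int a - q \<le> int (d n)" for a
  proof -
    have "n div 3 \<le> (n - 1) div 2" using npos by presburger
    then have "int (d n) = int ((n - 1) div 2) - q" unfolding d_eq q_def by simp
    then show ?thesis using npos by auto
  qed
  have *: "(\<forall>x\<in>A. \<forall>y\<in>A. \<forall>z\<in>A. x + y + z \<noteq> n) \<longleftrightarrow>
    (\<forall>s\<in>?f ` A. \<forall>t\<in>?f ` A. \<forall>u\<in>?f ` A. s + t + u \<noteq> b)" for A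
  proof -
    have "x + y + z = n \<longleftrightarrow> ?f x + ?f y + ?f z = b" for x y z using nq by linarith
    then show ?thesis by simp
  qed
  have "bij_betw (\<lambda>A. ?f ` A) {A. admissible n A \<and> card A = i} (sum_free_sets b K (d n) i)"
  proof (rule bij_betw_byWitness[where f' = "\<lambda>T. ?g ` T"])
    have adm: "A \<subseteq> {a. L \<le> a \<and> 2 * a < n}" if "admissible n A" "card A = i" for A
    proof
      fix x assume x: "x \<in> A"
      have "q + b + 2 * int i \<le> int x + 2 * int (d n) + 1"
        using admissible_ge[OF that(1) x] that(2) unfolding q_def b_def by linarith
      then have "int L \<le> int x" using i L unfolding K_def by linarith
      moreover have "2 * x < n" using x that(1) by (auto simp: admissible_def)
      ultimately show "x \<in> {a. L \<le> a \<and> 2 * a < n}" by simp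
    qed
    show "(\<lambda>A. ?f ` A) ` {A. admissible n A \<and> card A = i} \<subseteq> sum_free_sets b K (d n) i"
    proof clarify
      fix A assume A: "admissible n A" "i = card A"
      have sub: "A \<subseteq> {a. L \<le> a \<and> 2 * a < n}" using adm A by simp
      then have "?f ` A \<subseteq> {-K..int (d n)}" using d L by force
      moreover have "card (?f ` A) = card A" by (intro card_image) (auto simp: inj_on_def)
      moreover have "\<forall>s\<in>?f ` A. \<forall>t\<in>?f ` A. \<forall>u\<in>?f ` A. s + t + u \<noteq> b"
        using *[of A] admissible_iff_sum_free[OF sub L4 npos] A(1) by argo
      ultimately show "?f ` A \<in> sum_free_sets b K (d n) (card A)"
        unfolding sum_free_sets_def by (intro CollectI conjI)
    qed
    have fg: "?f ` ?g ` T = T" if "T \<in> sum_free_sets b K (d n) i" for T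
    proof -
      \<comment> \<open>No truncation by \<open>nat\<close> occurs:
        \<open>t + q \<ge> q - K = int L \<ge> 0\<close>.\<close>
      have "?f (?g t) = t" if "t \<in> T" for t
        using that \<open>T \<in> _\<close> L unfolding sum_free_sets_def by force
      then show ?thesis by (simp add: image_image)
    qed
    then show "\<forall>T\<in>sum_free_sets b K (d n) i. ?f ` ?g ` T = T" by blast
    show "\<forall>A\<in>{A. admissible n A \<and> card A = i}. ?g ` ?f ` A = A"
      by (simp add: image_image)
    show "(\<lambda>T. ?g ` T) ` sum_free_sets b K (d n) i \<subseteq> {A. admissible n A \<and> card A = i}"
    proof (rule image_subsetI)
      fix T assume T: "T \<in> sum_free_sets b K (d n) i"
      have "?g ` T \<subseteq> {a. L \<le> a \<and> 2 * a < n}"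
      proof (rule image_subsetI)
        fix t assume "t \<in> T"
        then have "-K \<le> t" "t \<le> int (d n)" using T unfolding sum_free_sets_def by auto
        then show "?g t \<in> {a. L \<le> a \<and> 2 * a < n}" using d[of "?g t"] L by auto
      qed
      then have "admissible n (?g ` T)"
        using admissible_iff_sum_free[OF _ L4 npos] *[of "?g ` T"] fg[OF T] T
        unfolding sum_free_sets_def by simp
      moreover have "card (?g ` T) = card (?f ` ?g ` T)"
        by (intro card_image[symmetric]) (auto simp: inj_on_def)
      ultimately show "?g ` T \<in> {A. admissible n A \<and> card A = i}"
        using fg[OF T] T unfolding sum_free_sets_def by simp
    qed
  qed
  then show ?thesis unfolding h_eq by (rule bij_betw_same_card)
qed

section \<open>Splitting off the unconstrained elements\<close>

text \<open>A summand above \<open>D\<close> with two others at least \<open>-K\<close> gives a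
  total above \<open>D - 2 * K \<ge> b\<close>. So the part of a set above \<open>D\<close> is
  arbitrary. The bound \<open>-K \<le> D + 1\<close> keeps \<open>{D<..D'}\<close> inside
  \<open>{-K..D'}\<close>.\<close>

lemma card_sum_free_sets_convolution:
  assumes "b + 2 * K \<le> D" "-K \<le> D + 1" "D \<le> D'"
  shows "card (sum_free_sets b K D' j) =
    (\<Sum>i\<le>j. card (sum_free_sets b K D i) * (nat (D' - D) choose (j - i)))"
proof -
  let ?U = "\<lambda>i. {U. U \<subseteq> {D<..D'} \<and> card U = i}"
  let ?f = "\<lambda>T. (card (T \<inter> {-K..D}), T \<inter> {-K..D}, T \<inter> {D<..D'})"
  let ?X = "SIGMA i:{..j}. sum_free_sets b K D i \<times> ?U (j - i)"
  have fin: "finite (sum_free_sets b K E i)" for E i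
    unfolding sum_free_sets_def by (rule finite_subset[of _ "Pow {-K..E}"]) auto
  have finU: "finite (?U i)" for i
    by (rule finite_subset[of _ "Pow {D<..D'}"]) auto
  have "bij_betw ?f (sum_free_sets b K D' j) ?X"
  proof (rule bij_betw_byWitness[where f' = "\<lambda>(i, S, U). S \<union> U"])
    show "\<forall>T\<in>sum_free_sets b K D' j. (case ?f T of (i, S, U) \<Rightarrow> S \<union> U) = T"
      using assms unfolding sum_free_sets_def by auto
    show "\<forall>p\<in>?X. ?f (case p of (i, S, U) \<Rightarrow> S \<union> U) = p"
    proof
      fix p assume "p \<in> ?X"
      then obtain i S U where p: "p = (i, S, U)"
        and "S \<in> sum_free_sets b K D i" "U \<subseteq> {D<..D'}"
        by auto
      then have "(S \<union> U) \<inter> {-K..D} = S" "(S \<union> U) \<inter> {D<..D'} = U" "card S = i"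
        unfolding sum_free_sets_def by auto
      then show "?f (case p of (i, S, U) \<Rightarrow> S \<union> U) = p" unfolding p by simp
    qed
    show "?f ` sum_free_sets b K D' j \<subseteq> ?X"
    proof (rule image_subsetI)
      fix T assume T: "T \<in> sum_free_sets b K D' j"
      let ?S = "T \<inter> {-K..D}" and ?V = "T \<inter> {D<..D'}"
      have "?S \<union> ?V = T" using T assms unfolding sum_free_sets_def by auto
      moreover have "card (?S \<union> ?V) = card ?S + card ?V"
        by (rule card_Un_disjoint) auto
      ultimately have "card ?S + card ?V = j" using T unfolding sum_free_sets_def by simp
      then show "?f T \<in> ?X" using T unfolding sum_free_sets_def by auto
    qed
    show "(\<lambda>(i, S, U). S \<union> U) ` ?X \<subseteq> sum_free_sets b K D' j"
    proof clarify
      fix i S U assume i: "i \<le> j" and S: "S \<in> sum_free_sets b K D i"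
        and U: "U \<subseteq> {D<..D'}" "card U = j - i"
      have sub: "S \<subseteq> {-K..D}" using S unfolding sum_free_sets_def by simp
      have "finite S" "finite U" using sub U(1) by (auto intro: finite_subset)
      moreover have "S \<inter> U = {}" using sub U(1) by fastforce
      ultimately have "card (S \<union> U) = j"
        using i S U(2) unfolding sum_free_sets_def by (simp add: card_Un_disjoint)
      moreover have "S \<union> U \<subseteq> {-K..D'}"
        using sub U(1) assms by fastforce
      moreover have "s + t + u \<noteq> b" if "s \<in> S \<union> U" "t \<in> S \<union> U" "u \<in> S \<union> U" for s t u
      proof
        assume eq: "s + t + u = b"
        have "-K \<le> s" "-K \<le> t" "-K \<le> u"
          using that \<open>S \<union> U \<subseteq> {-K..D'}\<close> by auto
        then have "s \<le> D" "t \<le> D" "u \<le> D" using eq assms(1) by linarith+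
        then have "s \<in> S" "t \<in> S" "u \<in> S" using that U(1) by auto
        then show False using S eq unfolding sum_free_sets_def by blast
      qed
      ultimately show "S \<union> U \<in> sum_free_sets b K D' j"
        unfolding sum_free_sets_def by blast
    qed
  qed
  then have "card (sum_free_sets b K D' j) = card ?X" by (rule bij_betw_same_card)
  also have "\<dots> = (\<Sum>i\<le>j. card (sum_free_sets b K D i) * (nat (D' - D) choose (j - i)))"
    using fin finU by (simp add: card_cartesian_product n_subsets)
  finally show ?thesis .
qed

theorem theorem1:
  fixes k b m n :: nat
  assumes "b \<in> {0, 1, 2}"
    and "int m > 24 * int k + 12 - 8 * int b"
    and "m mod 3 = b"
    and "n \<ge> m"
    and "n mod 3 = b"
  shows "h n (d n - k) = (\<Sum>l=0..k. h m (d m - l) * ((d n - d m) choose (k - l)))"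
proof -
  define K where "K = 2 * int k + 1 - int b"
  have k: "k \<le> d m" using d_ge assms by blast
  have dmn: "d m \<le> d n" using d_mono_mod_3 assms by simp
  have m: "3 * int (m div 3) + int b = int m" using assms(3) by presburger
  \<comment> \<open>Substituting \<open>m = 3 * q + b\<close> in the hypothesis on \<open>m\<close>
    and dividing by 3 gives \<open>q > 8 * k + 4 - 3 * b\<close>, which is
    \<open>4 * K + b\<close>.\<close>
  have qm: "4 * K + int b < int (m div 3)"
  proof -
    define q where "q = int (m div 3)"
    show ?thesis using m assms(2) unfolding K_def q_def[symmetric] by (simp add: algebra_simps)
  qed
  have qn: "4 * K + int b < int (n div 3)"
    using qm div_le_mono[OF assms(4), of 3] by linarith
  \<comment> \<open>With \<open>q = m div 3\<close>,
    \<open>2 * d m \<ge> q + b - 2 \<ge> 4 * K + 2 * b - 1\<close>; integrality absorbs the last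
    1.\<close>
  have Kd: "int b + 2 * K \<le> int (d m)"
    using qm m unfolding d_eq K_def by linarith
  have Kd': "- K \<le> int (d m) + 1" using assms(1) unfolding K_def by auto
  have hm: "h m i = card (sum_free_sets b K (d m) i)" if "d m \<le> i + k" for i
    using h_eq_card_sum_free_sets[of k m i] qm that assms(3) unfolding K_def by simp
  \<comment> \<open>The convolution index may run past \<open>d m\<close>; there the count vanishes
    by the size bound on admissible sets, carried over through \<open>hm\<close>.\<close>
  have zero: "card (sum_free_sets b K (d m) i) = 0" if "d m < i" for i
  proof -
    have "{A. admissible m A \<and> card A = i} = {}"
      using admissible_card_le_d that by fastforce
    then have "h m i = 0" unfolding h_eq by (simp only: card.empty)
    then show ?thesis using hm[of i] that by simp
  qed
  have "h n (d n - k) = card (sum_free_sets b K (d n) (d n - k))"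
    using h_eq_card_sum_free_sets[of k n "d n - k"] qn assms(5) unfolding K_def by simp
  also have "\<dots> = (\<Sum>i\<le>d n - k. card (sum_free_sets b K (d m) i) *
      ((d n - d m) choose (d n - k - i)))"
    using card_sum_free_sets_convolution[OF Kd Kd', of "int (d n)" "d n - k"] dmn
    by (simp add: nat_diff_distrib')
  \<comment> \<open>Terms with \<open>i > d m\<close> vanish by \<open>zero\<close>; those with
    \<open>i + k < d m\<close> have a binomial whose lower index exceeds the upper one.\<close>
  also have "\<dots> = (\<Sum>i | i \<le> d n - k \<and> i \<le> d m \<and> d m \<le> i + k.
      card (sum_free_sets b K (d m) i) * ((d n - d m) choose (d n - k - i)))"
  proof (intro sum.mono_neutral_right ballI)
    fix i assume "i \<in> {..d n - k} - {i. i \<le> d n - k \<and> i \<le> d m \<and> d m \<le> i + k}"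
    then consider "d m < i" | "d n - d m < d n - k - i" using k dmn by fastforce
    then show "card (sum_free_sets b K (d m) i) * ((d n - d m) choose (d n - k - i)) = 0"
      by cases (simp_all add: zero binomial_eq_0)
  qed auto
  \<comment> \<open>Substitute \<open>l = d m - i\<close> and use the symmetry of binomials. The
    condition \<open>k - l \<le> d n - d m\<close> reflects \<open>i \<le> d n - k\<close> and is
    what the symmetry requires.\<close>
  also have "\<dots> = (\<Sum>l | l \<le> k \<and> k - l \<le> d n - d m.
      h m (d m - l) * ((d n - d m) choose (k - l)))"
  proof (rule sum.reindex_bij_witness[where i = "\<lambda>l. d m - l" and j = "\<lambda>i. d m - i"])
    fix i assume i: "i \<in> {i. i \<le> d n - k \<and> i \<le> d m \<and> d m \<le> i + k}"
    then have "(d n - d m) choose (k - (d m - i)) = (d n - d m) choose (d n - k - i)"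
      using k dmn by (subst binomial_symmetric) (auto intro!: arg_cong2[of _ _ _ _ binomial])
    moreover have "d m - (d m - i) = i" "d m \<le> i + k" using i by auto
    ultimately show "h m (d m - (d m - i)) * ((d n - d m) choose (k - (d m - i))) =
      card (sum_free_sets b K (d m) i) * ((d n - d m) choose (d n - k - i))"
      using hm[of i] by simp
  qed (use k dmn in auto)
  also have "\<dots> = (\<Sum>l=0..k. h m (d m - l) * ((d n - d m) choose (k - l)))"
    by (intro sum.mono_neutral_left) (auto simp: binomial_eq_0)
  finally show ?thesis .
qed

end
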